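(* Let $q$ be a prime power, $m>1$ an integer, and let $A$ (of length $n_A$) and $B$ (of length $n_B$) be supplementary codes obtained from a partition of the columns of $H_m$. If $A$ has dimension $n_A-m$ and is completely regular with covering radius $\rho(A)=2$, then the supplementary code $B$ is completely regular with covering radius $\rho(B)\le 2$.
   Context: $\mathbb{F}_q$ is the finite field of order $q$; $d(\cdot,\cdot)$ is the Hamming distance on $\mathbb{F}_q^n$. For a code $C\subset\mathbb{F}_q^n$, $d(\mathbf v,C)=\min_{\mathbf x\in C}d(\mathbf v,\mathbf x)$, the covering radius is $\rho=\rho(C)=\max_{\mathbf v\in\mathbb{F}_q^n}d(\mathbf v,C)$, and $C(i)=\{\mathbf x\in\mathbb{F}_q^n: d(\mathbf x,C)=i\}$. Two vectors are neighbors if they are at distance $1$. $C$ is completely regular if for all $0\le l\le\rho$ every vector $\mathbf x\in C(l)$ has the same number $c_l$ of neighbors in $C(l-1)$ and the same number $b_l$ of neighbors in $C(l+1)$ (with $c_0=b_\rho=0$). Let $H_m$ be an $m\times n$ matrix over $\mathbb{F}_q$, $n=(q^m-1)/(q-1)$, whose columns form a maximal set of pairwise linearly independent vectors of $\mathbb{F}_q^m$ (a parity-check matrix of the $q$-ary Hamming code $\mathcal H_m$). Choose a non-empty subset of $n_A<n$ columns of $H_m$, let $H_A$ be the submatrix formed by them, and let $H_B$ be the submatrix formed by the remaining $n_B=n-n_A$ columns. The codes $A=\{\mathbf x\in\mathbb{F}_q^{n_A}:H_A\mathbf x^T=\mathbf 0^T\}$ and $B=\{\mathbf x\in\mathbb{F}_q^{n_B}:H_B\mathbf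 x^T=\mathbf 0^T\}$ are called supplementary to each other. *)

theory Defs
  imports
    "Jordan_Normal_Form.Matrix_Kernel"
    "Jordan_Normal_Form.DL_Submatrix"
begin

text \<open>
  The space of vectors of length \<^term>\<open>n\<close> over the finite field \<^typ>\<open>'a\<close> is
  \<^term>\<open>carrier_vec n\<close>, and \<^term>\<open>card (UNIV :: 'a set)\<close> is the order of the field.
  A code of length \<^term>\<open>n\<close> is a non-empty subset of \<^term>\<open>carrier_vec n\<close>. The notions below are
  meaningful for such codes only; \<open>Min\<close> and \<open>Max\<close> are then taken over finite non-empty sets.
\<close>

definition hamming_dist :: "'a vec \<Rightarrow> 'a vec \<Rightarrow> nat" where
  "hamming_dist u v = card {i. i < dim_vec u \<and> u $ i \<noteq> v $ i}"

definition dist_to_code :: "'a vec \<Rightarrow> 'a vec set \<Rightarrow> nat" where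
  "dist_to_code v C = Min (hamming_dist v ` C)"

definition covering_radius :: "nat \<Rightarrow> 'a::finite vec set \<Rightarrow> nat" where
  "covering_radius n C = Max ((\<lambda>v. dist_to_code v C) ` carrier_vec n)"

definition subconstituent :: "nat \<Rightarrow> 'a vec set \<Rightarrow> nat \<Rightarrow> 'a vec set" where
  "subconstituent n C i = {x \<in> carrier_vec n. dist_to_code x C = i}"

definition neighbors_in :: "'a vec \<Rightarrow> 'a vec set \<Rightarrow> 'a vec set" where
  "neighbors_in x X = {y \<in> X. hamming_dist x y = 1}"

text \<open>
  The condition on \<open>c\<close> is guarded by \<open>0 < l\<close> because \<open>l - 1\<close> truncates at \<open>l = 0\<close>, where the
  subconstituent with index \<open>-1\<close> is empty.
\<close>

definition completely_regular :: "nat \<Rightarrow> 'a::finite vec set \<Rightarrow> bool" where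
  "completely_regular n C \<longleftrightarrow>
     (\<exists>b c :: nat \<Rightarrow> nat.
        c 0 = 0 \<and> b (covering_radius n C) = 0 \<and>
        (\<forall>l \<le> covering_radius n C. \<forall>x \<in> subconstituent n C l.
           (0 < l \<longrightarrow> card (neighbors_in x (subconstituent n C (l - 1))) = c l) \<and>
           card (neighbors_in x (subconstituent n C (l + 1))) = b l))"

definition pairwise_lin_indpt :: "nat \<Rightarrow> 'a::field vec set \<Rightarrow> bool" where
  "pairwise_lin_indpt m V \<longleftrightarrow>
     V \<subseteq> carrier_vec m \<and>
     pairwise (\<lambda>u v. LinearCombinations.module.lin_indpt class_ring (module_vec TYPE('a) m) {u, v}) V"

text \<open>
  The division in the number of columns is exact. For \<open>m > 1\<close> there are at least three distinct
  columns, so pairwise independence excludes the zero column.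
\<close>

definition hamming_parity_check :: "nat \<Rightarrow> 'a::{field,finite} mat \<Rightarrow> bool" where
  "hamming_parity_check m H \<longleftrightarrow>
     H \<in> carrier_mat m ((card (UNIV :: 'a set) ^ m - 1) div (card (UNIV :: 'a set) - 1)) \<and>
     distinct (cols H) \<and>
     maximal (set (cols H)) (pairwise_lin_indpt m)"

end

theory Submission
  imports Defs
begin

text \<open>
  Let \<open>D\<close> be the set of nonzero multiples of the columns of a matrix \<open>M\<close>, and let the syndrome of a word
  \<open>x\<close> be \<open>M *\<^sub>v x\<close>. When the columns are pairwise independent, moving from a word to a
  neighbour adds an element of \<open>D\<close> to the syndrome, and every element of \<open>D\<close> is added exactly once. So
  distances to the code \<open>mat_kernel M\<close>, and the counts in the definition of complete regularity, can
  be read off in the Cayley graph of the syndrome space with connection set \<open>D\<close>: the levels \<open>0\<close> and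
  \<open>1\<close> are the words with syndrome \<open>0\<close> and with syndrome in \<open>D\<close>.
  
  If the code has covering radius two and all vectors are syndromes, level two belongs to the complement
  \<open>E\<close> of \<open>D \<union> {0}\<close>, and complete regularity says that the Cayley graph is strongly regular, that is, \<open>D\<close> is a
  partial difference set. The hypothesis on the dimension of \<open>A\<close> is used for the surjectivity of the
  syndrome map.
  
  For a parity-check matrix of a Hamming code the nonzero multiples of all columns are all nonzero
  vectors, each obtained once. So the set belonging to \<open>B\<close> is exactly \<open>E\<close>, and the Cayley graph of \<open>E\<close>
  is the complement of the one of \<open>D\<close>. Complements of strongly regular graphs are strongly regular
  (\<open>partial_difference_set_complement\<close>). Conversely a partial difference set gives a completely regular code
  of covering radius at most two (\<open>partial_difference_set_imp_completely_regular\<close>), even when the columns do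
  not span: in that case the set together with zero is a subspace, and the covering radius is at most
  one.
\<close>

section \<open>Vectors and matrices over a field\<close>

lemma finite_carrier_vec [simp]: "finite (carrier_vec n :: 'a::finite vec set)"
proof (rule finite_subset)
  show "carrier_vec n \<subseteq> vec_of_list ` {xs :: 'a list. set xs \<subseteq> UNIV \<and> length xs = n}"
  proof
    fix v :: "'a vec" assume "v \<in> carrier_vec n"
    then show "v \<in> vec_of_list ` {xs. set xs \<subseteq> UNIV \<and> length xs = n}"
      by (intro image_eqI[of _ _ "list_of_vec v"]) (auto simp: vec_list)
  qed
  show "finite (vec_of_list ` {xs :: 'a list. set xs \<subseteq> UNIV \<and> length xs = n})"
    by (intro finite_imageI finite_lists_length_eq finite)
qed

lemma smult_vec_eq_zero_iff:
  fixes v :: "'a::field vec"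
  assumes "v \<in> carrier_vec m"
  shows "a \<cdot>\<^sub>v v = 0\<^sub>v m \<longleftrightarrow> a = 0 \<or> v = 0\<^sub>v m"
  using assms by (auto simp: vec_eq_iff)

lemma add_vec_eq_zero_iff:
  fixes u v :: "'a::group_add vec"
  assumes "u \<in> carrier_vec m" "v \<in> carrier_vec m"
  shows "u + v = 0\<^sub>v m \<longleftrightarrow> u = - v"
  using assms by (auto simp: vec_eq_iff eq_neg_iff_add_eq_0)

lemma uminus_smult_vec:
  fixes v :: "'a::ring vec"
  shows "- (a \<cdot>\<^sub>v v) = (- a) \<cdot>\<^sub>v v"
  by (auto simp: vec_eq_iff)

lemma smult_eq_smult_vec:
  fixes u v :: "'a::field vec"
  assumes "a \<cdot>\<^sub>v u = b \<cdot>\<^sub>v v" "a \<noteq> 0"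
  shows "u = (b / a) \<cdot>\<^sub>v v"
proof -
  have "u = (1 / a) \<cdot>\<^sub>v (a \<cdot>\<^sub>v u)" using assms(2) by (auto simp: vec_eq_iff)
  also have "\<dots> = (b / a) \<cdot>\<^sub>v v" by (simp add: assms(1) smult_smult_assoc)
  finally show ?thesis .
qed

lemma lin_indpt_pair_iff:
  fixes u v :: "'a::field vec"
  assumes u: "u \<in> carrier_vec m" and v: "v \<in> carrier_vec m" and uv: "u \<noteq> v"
  shows "LinearCombinations.module.lin_indpt class_ring (module_vec TYPE('a) m) {u, v} \<longleftrightarrow>
    (\<forall>a b. a \<cdot>\<^sub>v u + b \<cdot>\<^sub>v v = 0\<^sub>v m \<longrightarrow> a = 0 \<and> b = 0)"
proof -
  interpret V: vec_space "TYPE('a)" m .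
  have lc: "V.lincomb f {u, v} = f u \<cdot>\<^sub>v u + f v \<cdot>\<^sub>v v" for f :: "'a vec \<Rightarrow> 'a"
    using u v uv by (subst V.lincomb_insert2) (auto simp: V.lincomb_def)
  have uvc: "{u, v} \<subseteq> carrier V.V" using u v by simp
  show ?thesis
  proof
    assume li: "V.lin_indpt {u, v}"
    show "\<forall>a b. a \<cdot>\<^sub>v u + b \<cdot>\<^sub>v v = 0\<^sub>v m \<longrightarrow> a = 0 \<and> b = 0"
    proof (intro allI impI)
      fix a b assume z: "a \<cdot>\<^sub>v u + b \<cdot>\<^sub>v v = 0\<^sub>v m"
      define f where "f = (\<lambda>w. if w = u then a else b)"
      have f: "V.lincomb f {u, v} = 0\<^sub>v m"
        using z uv by (simp add: lc f_def)
      have "f w = 0" if "w \<in> {u, v}" for w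
        using V.lin_dep_crit[of "{u, v}" "{u, v}" w f] li that f by auto
      from this[of u] this[of v] show "a = 0 \<and> b = 0" using uv by (auto simp: f_def)
    qed
  next
    assume "\<forall>a b. a \<cdot>\<^sub>v u + b \<cdot>\<^sub>v v = 0\<^sub>v m \<longrightarrow> a = 0 \<and> b = 0"
    then show "V.lin_indpt {u, v}"
      using uvc by (intro V.finite_lin_indpt2) (auto simp: lc)
  qed
qed

text \<open>
  Rank-nullity gives the image dimension \<open>m\<close>, so a basis of the image is a basis of the whole space.
\<close>

lemma image_mult_mat_vec_eq_carrier_vec:
  fixes M :: "'a::{field,finite} mat"
  assumes M: "M \<in> carrier_mat m k" and dim: "int (kernel_dim M) = int k - int m"
  shows "(\<lambda>x. M *\<^sub>v x) ` carrier_vec k = carrier_vec m"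
proof -
  interpret K: kernel m k M by (unfold_locales, rule M)
  interpret W: vec_space "TYPE('a)" m .
  interpret T: linear_map class_ring K.NC.V W.V "\<lambda>x. M *\<^sub>v x"
  proof unfold_locales
    show "(\<lambda>x. M *\<^sub>v x) \<in> LinearCombinations.module_hom class_ring K.NC.V W.V"
      using M by (auto simp: LinearCombinations.module_hom_def mult_add_distrib_mat_vec mult_mat_vec)
  qed

  have ker: "T.kerT = mat_kernel M"
    using M by (auto simp: T.ker_def mat_kernel_def)
  have rn: "vectorspace.dim class_ring (W.vs T.imT) + K.dim = k"
    using T.rank_nullity_main(1)[OF K.NC.fin_dim] K.NC.dim_is_n by (simp add: ker)
  then have dim_im: "vectorspace.dim class_ring (W.vs T.imT) = m"
    using dim M by (simp add: K.kernel_dim)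
  have sub: "VectorSpace.subspace class_ring T.imT W.V" by (rule T.imT_is_subspace)
  interpret im: vectorspace class_ring "W.vs T.imT" by (rule W.subspace_is_vs[OF sub])
  have im_sub: "T.imT \<subseteq> carrier_vec m" using M by (auto simp: T.im_def)
  then have "finite T.imT" by (rule finite_subset) simp
  moreover have "im.span T.imT = T.imT"
    using im.in_own_span[of T.imT] im.span_is_subset2[of T.imT] by simp
  ultimately have "im.fin_dim" by (auto simp: im.fin_dim_def)
  then obtain B where B: "finite B" "im.basis B" "card B = m"
    using im.finite_basis_exists im.dim_basis dim_im by metis
  then have Bim: "B \<subseteq> T.imT" and Bspan: "im.span B = T.imT" and Bli: "im.lin_indpt B"
    by (auto simp: im.basis_def)
  have subm: "LinearCombinations.submodule class_ring T.imT W.V" using sub by (simp add: VectorSpace.subspace_def)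
  have "W.basis B"
    using im_sub B Bim Bli W.span_li_not_depend(2)[OF Bim subm] by (intro W.dim_li_is_basis) (auto simp: W.dim_is_n)
  then have "T.imT = carrier_vec m"
    using Bspan W.span_li_not_depend(1)[OF Bim subm] by (simp add: W.basis_def)
  then show ?thesis by (simp add: T.im_def)
qed

section \<open>Partial difference sets and their complements\<close>

text \<open>
  For \<open>D = -D\<close> not containing zero, \<open>card {d \<in> D. s + d \<in> D}\<close> is the number of ways to write \<open>s\<close> as a
  difference of two elements of \<open>D\<close>, so this is the usual notion with parameters \<open>l\<close>
  (usually \<open>\<lambda>\<close>) and \<open>\<mu>\<close>: the Cayley graph of \<open>D\<close> is strongly regular, except that \<open>D\<close> may be empty
  or consist of all nonzero vectors.
\<close>

definition partial_difference_set :: "nat \<Rightarrow> 'a::ab_group_add vec set \<Rightarrow> bool" where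
  "partial_difference_set m D \<longleftrightarrow>
    (\<exists>l \<mu>. (\<forall>s\<in>D. card {d \<in> D. s + d \<in> D} = l) \<and>
      (\<forall>s\<in>carrier_vec m - insert (0\<^sub>v m) D. card {d \<in> D. s + d \<in> D} = \<mu>))"

text \<open>
  The three sets on the right are classes of \<open>F\<close> by the position of \<open>s + d\<close>, so two of the counts
  determine the third once \<open>F\<close> is given.
\<close>

lemma card_translates_split:
  fixes D :: "'a::{ab_group_add,finite} vec set"
  assumes D: "D \<subseteq> carrier_vec m" and zero: "0\<^sub>v m \<notin> D"
    and F: "F \<subseteq> carrier_vec m" and s: "s \<in> carrier_vec m"
  shows "card F = card {d \<in> F. s + d = 0\<^sub>v m} + card {d \<in> F. s + d \<in> D} +
    card {d \<in> F. s + d \<in> carrier_vec m - insert (0\<^sub>v m) D}"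
proof -
  let ?Z = "{d \<in> F. s + d = 0\<^sub>v m}" and ?P = "{d \<in> F. s + d \<in> D}"
    and ?Q = "{d \<in> F. s + d \<in> carrier_vec m - insert (0\<^sub>v m) D}"
  have fin: "finite F" using F by (rule finite_subset) simp
  have closed: "s + d \<in> carrier_vec m" if "d \<in> F" for d
    using subsetD[OF F that] s by simp
  have "(?Z \<union> ?P) \<union> ?Q = F" using closed by blast
  moreover have "card ((?Z \<union> ?P) \<union> ?Q) = card (?Z \<union> ?P) + card ?Q"
    using fin by (intro card_Un_disjoint) auto
  moreover have "card (?Z \<union> ?P) = card ?Z + card ?P"
    using fin zero by (intro card_Un_disjoint) auto
  ultimately show ?thesis by simp
qed

lemma card_translates_to_zero:
  fixes F :: "'a::ab_group_add vec set"
  assumes F: "F \<subseteq> carrier_vec m" and sym: "\<And>d. d \<in> F \<Longrightarrow> - d \<in> F" and s: "s \<in> carrier_vec m"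
  shows "card {d \<in> F. s + d = 0\<^sub>v m} = (if s \<in> F then 1 else 0)"
proof -
  have "s + d = 0\<^sub>v m \<longleftrightarrow> d = - s" if "d \<in> F" for d
    using F s that add_vec_eq_zero_iff[of d m s] by (auto simp: comm_add_vec[of s m d])
  then have "{d \<in> F. s + d = 0\<^sub>v m} = (if s \<in> F then {- s} else {})"
    using sym[of s] sym[of "- s"] by auto
  then show ?thesis by simp
qed

text \<open>
  The involution \<open>d \<mapsto> - (s + d)\<close> exchanges the two sets. It relates counts over the
  complement of a connection set to counts over the set itself.
\<close>

lemma card_translates_swap:
  fixes D E :: "'a::{ab_group_add,finite} vec set"
  assumes D: "D \<subseteq> carrier_vec m" "\<And>d. d \<in> D \<Longrightarrow> - d \<in> D"
    and E: "E \<subseteq> carrier_vec m" "\<And>d. d \<in> E \<Longrightarrow> - d \<in> E" and s: "s \<in> carrier_vec m"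
  shows "card {d \<in> E. s + d \<in> D} = card {d \<in> D. s + d \<in> E}"
proof (rule bij_betw_same_card)
  have *: "s + - (s + d) = - d" "- (s + - (s + d)) = d" if "d \<in> carrier_vec m" for d
    using s that by (intro eq_vecI; simp)+
  show "bij_betw (\<lambda>d. - (s + d)) {d \<in> E. s + d \<in> D} {d \<in> D. s + d \<in> E}"
  proof (rule bij_betw_byWitness[where f' = "\<lambda>d. - (s + d)"])
    show "\<forall>d\<in>{d \<in> E. s + d \<in> D}. - (s + - (s + d)) = d"
      "\<forall>d\<in>{d \<in> D. s + d \<in> E}. - (s + - (s + d)) = d"
      using *(2) D(1) E(1) by blast+
    show "(\<lambda>d. - (s + d)) ` {d \<in> E. s + d \<in> D} \<subseteq> {d \<in> D. s + d \<in> E}"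
    proof (intro image_subsetI CollectI conjI)
      fix d assume d: "d \<in> {d \<in> E. s + d \<in> D}"
      then show "- (s + d) \<in> D" using D(2) by blast
      have "s + - (s + d) = - d" using d E(1) *(1) by blast
      then show "s + - (s + d) \<in> E" using d E(2) by simp
    qed
    show "(\<lambda>d. - (s + d)) ` {d \<in> D. s + d \<in> E} \<subseteq> {d \<in> E. s + d \<in> D}"
    proof (intro image_subsetI CollectI conjI)
      fix d assume d: "d \<in> {d \<in> D. s + d \<in> E}"
      then show "- (s + d) \<in> E" using E(2) by blast
      have "s + - (s + d) = - d" using d D(1) *(1) by blast
      then show "s + - (s + d) \<in> D" using d D(2) by simp
    qed
  qed
qed

text \<open>
  The complement of a strongly regular graph is strongly regular. Here, with \<open>E\<close> the complementary
  set, splitting \<open>D\<close> and \<open>E\<close> by the position of \<open>s + d\<close> leaves only the mixed count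
  \<open>card {d \<in> E. s + d \<in> D}\<close> to be known, and exchanging \<open>D\<close> and \<open>E\<close> in it reduces it to the
  parameters of \<open>D\<close>.
\<close>

lemma partial_difference_set_complement:
  fixes D :: "'a::{ab_group_add,finite} vec set"
  assumes D: "D \<subseteq> carrier_vec m" "0\<^sub>v m \<notin> D" "\<And>d. d \<in> D \<Longrightarrow> - d \<in> D"
    and pds: "partial_difference_set m D"
  shows "partial_difference_set m (carrier_vec m - insert (0\<^sub>v m) D)" (is "partial_difference_set m ?E")
proof -
  from pds obtain l \<mu> where l: "\<And>s. s \<in> D \<Longrightarrow> card {d \<in> D. s + d \<in> D} = l"
    and \<mu>: "\<And>s. s \<in> ?E \<Longrightarrow> card {d \<in> D. s + d \<in> D} = \<mu>"
    unfolding partial_difference_set_def by blast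
  have E: "?E \<subseteq> carrier_vec m" by blast
  have E_sym: "- d \<in> ?E" if "d \<in> ?E" for d
  proof -
    from that have d: "d \<in> carrier_vec m" "d \<noteq> 0\<^sub>v m" "d \<notin> D" by auto
    have dd: "- (- d) = d" by simp
    have "- d \<noteq> 0\<^sub>v m"
    proof
      assume "- d = 0\<^sub>v m"
      then have "0\<^sub>v m + d = - d + d" by simp
      with d show False by simp
    qed
    moreover have "- d \<notin> D" using D(3)[of "- d"] dd d(3) by auto
    ultimately show ?thesis using d(1) by simp
  qed
  have D_split: "card D = (if s \<in> D then 1 else 0) + card {d \<in> D. s + d \<in> D} + card {d \<in> D. s + d \<in> ?E}"
    if s: "s \<in> carrier_vec m" for s
    by (subst card_translates_split[OF D(1,2) D(1) s], subst card_translates_to_zero[OF D(1,3) s]) simp_all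
  have E_split: "card ?E = (if s \<in> ?E then 1 else 0) + card {d \<in> D. s + d \<in> ?E} + card {d \<in> ?E. s + d \<in> ?E}"
    if s: "s \<in> carrier_vec m" for s
    using card_translates_split[OF D(1,2) E s] card_translates_to_zero[OF E E_sym s]
      card_translates_swap[OF D(1,3) E E_sym s] by linarith
  have 1: "card {d \<in> ?E. s + d \<in> ?E} = card ?E - 1 - (card D - \<mu>)" if "s \<in> ?E" for s
    using D_split[of s] E_split[of s] \<mu>[OF that] that by simp
  have 2: "card {d \<in> ?E. s + d \<in> ?E} = card ?E - (card D - 1 - l)"
    if "s \<in> carrier_vec m - insert (0\<^sub>v m) ?E" for s
    using D_split[of s] E_split[of s] l[of s] that by (simp split: if_splits)
  show ?thesis
    unfolding partial_difference_set_def
    by (rule exI, rule exI, intro conjI ballI, erule 1, erule 2)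
qed

section \<open>Hamming distance\<close>

lemma dist_to_code_le_iff:
  assumes "finite C" "C \<noteq> {}"
  shows "dist_to_code v C \<le> r \<longleftrightarrow> (\<exists>c\<in>C. hamming_dist v c \<le> r)"
  using assms by (simp add: dist_to_code_def Min_le_iff)

lemma hamming_dist_eq_0_iff:
  assumes "x \<in> carrier_vec k" "y \<in> carrier_vec k"
  shows "hamming_dist x y = 0 \<longleftrightarrow> x = y"
proof
  assume "hamming_dist x y = 0"
  then have "{i. i < dim_vec x \<and> x $ i \<noteq> y $ i} = {}"
    by (simp add: hamming_dist_def)
  then show "x = y" using assms by (intro eq_vecI) auto
qed (simp add: hamming_dist_def)

lemma hamming_dist_triangle:
  assumes "x \<in> carrier_vec k" "y \<in> carrier_vec k"
  shows "hamming_dist x z \<le> hamming_dist x y + hamming_dist y z"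
proof -
  have "hamming_dist x z \<le> card ({i. i < dim_vec x \<and> x $ i \<noteq> y $ i} \<union> {i. i < dim_vec y \<and> y $ i \<noteq> z $ i})"
    unfolding hamming_dist_def using assms by (intro card_mono) auto
  also have "\<dots> \<le> hamming_dist x y + hamming_dist y z"
    unfolding hamming_dist_def by (rule card_Un_le)
  finally show ?thesis .
qed

lemma hamming_dist_eq_1_iff:
  fixes x y :: "'a::ring_1 vec"
  assumes x: "x \<in> carrier_vec k" and y: "y \<in> carrier_vec k"
  shows "hamming_dist x y = 1 \<longleftrightarrow> (\<exists>a i. a \<noteq> 0 \<and> i < k \<and> y = x + a \<cdot>\<^sub>v unit_vec k i)"
proof
  assume "hamming_dist x y = 1"
  then obtain i where i: "{j. j < dim_vec x \<and> x $ j \<noteq> y $ j} = {i}"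
    unfolding hamming_dist_def by (auto simp: card_1_singleton_iff)
  then have "i < k" "x $ i \<noteq> y $ i" and eq: "\<And>j. j < k \<Longrightarrow> j \<noteq> i \<Longrightarrow> x $ j = y $ j"
    using x by auto
  moreover have "y = x + (y $ i - x $ i) \<cdot>\<^sub>v unit_vec k i"
    using x y eq by (auto simp: vec_eq_iff unit_vec_def)
  ultimately show "\<exists>a i. a \<noteq> 0 \<and> i < k \<and> y = x + a \<cdot>\<^sub>v unit_vec k i"
    by (intro exI[of _ "y $ i - x $ i"] exI[of _ i]) auto
next
  assume "\<exists>a i. a \<noteq> 0 \<and> i < k \<and> y = x + a \<cdot>\<^sub>v unit_vec k i"
  then obtain a i where "a \<noteq> 0" "i < k" "y = x + a \<cdot>\<^sub>v unit_vec k i" by blast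
  then have "{j. j < dim_vec x \<and> x $ j \<noteq> y $ j} = {i}"
    using x by (auto simp: unit_vec_def split: if_splits)
  then show "hamming_dist x y = 1" by (simp add: hamming_dist_def)
qed

section \<open>Projective systems and their codes\<close>

text \<open>
  The columns are regarded as points of the projective space over \<open>'a\<close>; the set consists of all
  nonzero vectors on these points.
\<close>

definition points :: "'a::field mat \<Rightarrow> 'a vec set" where
  "points M = {a \<cdot>\<^sub>v col M i | a i. a \<noteq> 0 \<and> i < dim_col M}"

text \<open>
  Distinct columns represent distinct projective points. The injectivity condition also fixes the
  scalar, so that every element of \<open>points M\<close> comes from exactly one single-coordinate change of a word;
  this makes neighbours of a word correspond to elements of \<open>points M\<close>.
\<close>

locale projective_system =
  fixes m k :: nat and M :: "'a::{field,finite} mat"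
  assumes M: "M \<in> carrier_mat m k"
    and smult_col_inj: "\<And>a b i j. a \<cdot>\<^sub>v col M i = b \<cdot>\<^sub>v col M j \<Longrightarrow> a \<noteq> 0 \<Longrightarrow> b \<noteq> 0 \<Longrightarrow>
      i < k \<Longrightarrow> j < k \<Longrightarrow> a = b \<and> i = j"
    and col_nonzero: "\<And>i. i < k \<Longrightarrow> col M i \<noteq> 0\<^sub>v m"

context projective_system
begin

abbreviation D :: "'a vec set" where "D \<equiv> points M"
abbreviation E :: "'a vec set" where "E \<equiv> carrier_vec m - insert (0\<^sub>v m) D"
abbreviation C :: "'a vec set" where "C \<equiv> mat_kernel M"

lemma col_carrier: "col M i \<in> carrier_vec m" using M by auto

lemma points_carrier: "D \<subseteq> carrier_vec m"
  using col_carrier by (auto simp: points_def)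

lemma zero_notin_points: "0\<^sub>v m \<notin> D"
proof
  assume "0\<^sub>v m \<in> D"
  then obtain a i where *: "a \<noteq> 0" "i < k" "0\<^sub>v m = a \<cdot>\<^sub>v col M i" using M by (auto simp: points_def)
  then show False using smult_vec_eq_zero_iff[OF col_carrier, of a i] col_nonzero by auto
qed

lemma points_uminus: "d \<in> D \<Longrightarrow> - d \<in> D"
  by (auto simp: points_def uminus_smult_vec) (metis neg_equal_0_iff_equal)

lemma syndrome_carrier: "x \<in> carrier_vec k \<Longrightarrow> M *\<^sub>v x \<in> carrier_vec m"
  using M by simp

lemma syndrome_zero: "M *\<^sub>v 0\<^sub>v k = 0\<^sub>v m"
  using M by auto

lemma syndrome_unit:
  assumes "i < k" shows "M *\<^sub>v (a \<cdot>\<^sub>v unit_vec k i) = a \<cdot>\<^sub>v col M i"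
proof -
  have "M *\<^sub>v unit_vec k i = col (M * 1\<^sub>m k) i"
    using assms M by (subst col_mult2) auto
  then show ?thesis using M by (simp add: mult_mat_vec[OF M])
qed

lemma syndrome_step:
  assumes "x \<in> carrier_vec k" "i < k"
  shows "M *\<^sub>v (x + a \<cdot>\<^sub>v unit_vec k i) = M *\<^sub>v x + a \<cdot>\<^sub>v col M i"
  using assms by (simp add: mult_add_distrib_mat_vec[OF M] syndrome_unit)

text \<open>
  Changing coordinate \<open>i\<close> by \<open>a \<noteq> 0\<close> changes the syndrome by \<open>a \<cdot>\<^sub>v col M i\<close>. So the
  neighbourhood of a word in the Hamming graph is mapped bijectively to the neighbourhood of its syndrome
  in the Cayley graph with connection set \<open>points M\<close>.
\<close>

lemma neighbor_syndromes_bij: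
  assumes x: "x \<in> carrier_vec k"
  shows "bij_betw (\<lambda>y. M *\<^sub>v y - M *\<^sub>v x) (neighbors_in x (carrier_vec k)) D"
proof -
  have diff: "M *\<^sub>v (x + a \<cdot>\<^sub>v unit_vec k i) - M *\<^sub>v x = a \<cdot>\<^sub>v col M i" if "i < k" for a i
    using that x syndrome_carrier[OF x] col_carrier[of i] 
    by (auto simp: syndrome_step vec_eq_iff)
  have "y \<in> neighbors_in x (carrier_vec k) \<longleftrightarrow> (\<exists>a i. a \<noteq> 0 \<and> i < k \<and> y = x + a \<cdot>\<^sub>v unit_vec k i)" for y
  proof (cases "y \<in> carrier_vec k")
    case True
    then show ?thesis using hamming_dist_eq_1_iff[OF x True] by (simp add: neighbors_in_def)
  next
    case False
    then show ?thesis using x by (auto simp: neighbors_in_def)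
  qed
  then have N: "neighbors_in x (carrier_vec k) = {x + a \<cdot>\<^sub>v unit_vec k i | a i. a \<noteq> 0 \<and> i < k}"
    by blast
  show ?thesis
  proof (rule bij_betw_imageI)
    show "inj_on (\<lambda>y. M *\<^sub>v y - M *\<^sub>v x) (neighbors_in x (carrier_vec k))"
    proof (rule inj_onI)
      fix y z assume "y \<in> neighbors_in x (carrier_vec k)" "z \<in> neighbors_in x (carrier_vec k)"
        and eq: "M *\<^sub>v y - M *\<^sub>v x = M *\<^sub>v z - M *\<^sub>v x"
      then obtain a i b j where yz: "y = x + a \<cdot>\<^sub>v unit_vec k i" "z = x + b \<cdot>\<^sub>v unit_vec k j"
        and ab: "a \<noteq> 0" "b \<noteq> 0" and ij: "i < k" "j < k" unfolding N by blast
      then have "a \<cdot>\<^sub>v col M i = b \<cdot>\<^sub>v col M j" using eq diff by simp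
      from smult_col_inj[OF this ab ij] show "y = z" by (simp add: yz)
    qed
    show "(\<lambda>y. M *\<^sub>v y - M *\<^sub>v x) ` neighbors_in x (carrier_vec k) = D"
    proof (intro equalityI subsetI)
      fix d assume "d \<in> (\<lambda>y. M *\<^sub>v y - M *\<^sub>v x) ` neighbors_in x (carrier_vec k)"
      then obtain a i where "d = M *\<^sub>v (x + a \<cdot>\<^sub>v unit_vec k i) - M *\<^sub>v x" "a \<noteq> 0" "i < k"
        unfolding N by blast
      then show "d \<in> D" using M by (auto simp: diff points_def)
    next
      fix d assume "d \<in> D"
      then obtain a i where d: "d = a \<cdot>\<^sub>v col M i" "a \<noteq> 0" "i < k" using M by (auto simp: points_def)
      then show "d \<in> (\<lambda>y. M *\<^sub>v y - M *\<^sub>v x) ` neighbors_in x (carrier_vec k)"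
        unfolding N using diff[OF d(3), of a] by (intro image_eqI[of _ _ "x + a \<cdot>\<^sub>v unit_vec k i"]) auto
    qed
  qed
qed

lemma syndrome_eq_add:
  assumes "x \<in> carrier_vec k" "y \<in> carrier_vec k"
  shows "M *\<^sub>v y = M *\<^sub>v x + (M *\<^sub>v y - M *\<^sub>v x)"
  using syndrome_carrier[OF assms(1)] syndrome_carrier[OF assms(2)]
  by (intro eq_vecI) (simp_all del: index_mult_mat_vec dim_mult_mat_vec)

lemma card_neighbors_by_syndrome:
  assumes x: "x \<in> carrier_vec k"
  shows "card (neighbors_in x {y \<in> carrier_vec k. M *\<^sub>v y \<in> T}) = card {d \<in> D. M *\<^sub>v x + d \<in> T}"
proof (rule bij_betw_same_card)
  let ?f = "\<lambda>y. M *\<^sub>v y - M *\<^sub>v x" and ?N = "neighbors_in x {y \<in> carrier_vec k. M *\<^sub>v y \<in> T}"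
  have sub: "?N \<subseteq> neighbors_in x (carrier_vec k)" by (auto simp: neighbors_in_def)
  have mem: "y \<in> ?N \<longleftrightarrow> M *\<^sub>v x + ?f y \<in> T" if "y \<in> neighbors_in x (carrier_vec k)" for y
    using that syndrome_eq_add[OF x, of y] by (auto simp: neighbors_in_def)
  have "?f ` ?N = {d \<in> D. M *\<^sub>v x + d \<in> T}"
  proof (intro equalityI subsetI)
    fix d assume "d \<in> ?f ` ?N"
    then show "d \<in> {d \<in> D. M *\<^sub>v x + d \<in> T}"
      using sub mem bij_betw_imp_surj_on[OF neighbor_syndromes_bij[OF x]] by blast
  next
    fix d assume d: "d \<in> {d \<in> D. M *\<^sub>v x + d \<in> T}"
    then obtain y where "y \<in> neighbors_in x (carrier_vec k)" "d = ?f y"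
      using bij_betw_imp_surj_on[OF neighbor_syndromes_bij[OF x]] by blast
    then show "d \<in> ?f ` ?N" using d mem by blast
  qed
  then show "bij_betw ?f ?N {d \<in> D. M *\<^sub>v x + d \<in> T}"
    using bij_betw_subset[OF neighbor_syndromes_bij[OF x] sub] by simp
qed

lemma neighbor_exists:
  assumes x: "x \<in> carrier_vec k" and d: "d \<in> D"
  obtains y where "y \<in> carrier_vec k" "hamming_dist x y = 1" "M *\<^sub>v y = M *\<^sub>v x + d"
proof -
  obtain y where "y \<in> neighbors_in x (carrier_vec k)" "d = M *\<^sub>v y - M *\<^sub>v x"
    using d bij_betw_imp_surj_on[OF neighbor_syndromes_bij[OF x]] by blast
  then show thesis using that[of y] syndrome_eq_add[OF x, of y] by (auto simp: neighbors_in_def)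
qed

lemma kernel_iff: "x \<in> C \<longleftrightarrow> x \<in> carrier_vec k \<and> M *\<^sub>v x = 0\<^sub>v m"
  using M by (auto simp: mat_kernel_def)

lemma dist_le_iff: "dist_to_code x C \<le> r \<longleftrightarrow> (\<exists>c\<in>C. hamming_dist x c \<le> r)"
proof (rule dist_to_code_le_iff)
  show "finite C" by (rule finite_subset[of _ "carrier_vec k"]) (auto simp: kernel_iff)
  have "0\<^sub>v k \<in> C" by (simp add: kernel_iff syndrome_zero)
  then show "C \<noteq> {}" by blast
qed

lemma dist_eq_0_iff:
  assumes x: "x \<in> carrier_vec k"
  shows "dist_to_code x C = 0 \<longleftrightarrow> M *\<^sub>v x = 0\<^sub>v m"
proof -
  have "dist_to_code x C \<le> 0 \<longleftrightarrow> x \<in> C"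
    unfolding dist_le_iff using hamming_dist_eq_0_iff[OF x] x by (auto simp: kernel_iff)
  then show ?thesis using x by (simp add: kernel_iff)
qed

lemma dist_le_1_iff:
  assumes x: "x \<in> carrier_vec k"
  shows "dist_to_code x C \<le> 1 \<longleftrightarrow> M *\<^sub>v x \<in> insert (0\<^sub>v m) D"
proof
  assume "dist_to_code x C \<le> 1"
  then obtain c where c: "c \<in> C" "hamming_dist x c \<le> 1" unfolding dist_le_iff by blast
  show "M *\<^sub>v x \<in> insert (0\<^sub>v m) D"
  proof (cases "hamming_dist x c = 0")
    case True
    then show ?thesis using hamming_dist_eq_0_iff[OF x] c by (auto simp: kernel_iff)
  next
    case False
    with c have "c \<in> neighbors_in x (carrier_vec k)" by (auto simp: neighbors_in_def kernel_iff)
    then have d: "M *\<^sub>v c - M *\<^sub>v x \<in> D"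
      using bij_betw_imp_surj_on[OF neighbor_syndromes_bij[OF x]] by blast
    have "M *\<^sub>v x = - (M *\<^sub>v c - M *\<^sub>v x)"
      using c syndrome_carrier[OF x] by (auto simp: kernel_iff)
    then show ?thesis using points_uminus[OF d] by simp
  qed
next
  assume "M *\<^sub>v x \<in> insert (0\<^sub>v m) D"
  then consider "M *\<^sub>v x = 0\<^sub>v m" | "M *\<^sub>v x \<in> D" by blast
  then show "dist_to_code x C \<le> 1"
  proof cases
    case 1
    then show ?thesis using dist_eq_0_iff[OF x] by simp
  next
    case 2
    obtain c where "c \<in> carrier_vec k" "hamming_dist x c = 1" "M *\<^sub>v c = M *\<^sub>v x + - (M *\<^sub>v x)"
      using neighbor_exists[OF x points_uminus[OF 2]] by blast
    then show ?thesis unfolding dist_le_iff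
      using syndrome_carrier[OF x] by (intro bexI[of _ c]) (auto simp: kernel_iff)
  qed
qed

text \<open>
  A path of length two from the syndrome to zero in the Cayley graph lifts to a path from the word to
  a codeword.
\<close>

lemma dist_le_2:
  assumes x: "x \<in> carrier_vec k" and d: "d \<in> D" "M *\<^sub>v x + d \<in> D"
  shows "dist_to_code x C \<le> 2"
proof -
  obtain y where y: "y \<in> carrier_vec k" "hamming_dist x y = 1" "M *\<^sub>v y = M *\<^sub>v x + d"
    using neighbor_exists[OF x d(1)] by blast
  then have "dist_to_code y C \<le> 1" using d dist_le_1_iff by simp
  then obtain c where "c \<in> C" "hamming_dist y c \<le> 1" unfolding dist_le_iff by blast
  then show ?thesis unfolding dist_le_iff
    using hamming_dist_triangle[OF x y(1), of c] y(2) by (intro bexI[of _ c]) auto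
qed

lemma subconstituent_0: "subconstituent k C 0 = {x \<in> carrier_vec k. M *\<^sub>v x \<in> {0\<^sub>v m}}"
  using dist_eq_0_iff by (auto simp: subconstituent_def)

lemma subconstituent_1: "subconstituent k C (Suc 0) = {x \<in> carrier_vec k. M *\<^sub>v x \<in> D}"
proof -
  have "dist_to_code x C = 1 \<longleftrightarrow> M *\<^sub>v x \<in> D" if "x \<in> carrier_vec k" for x
    using dist_le_1_iff[OF that] dist_eq_0_iff[OF that] zero_notin_points by auto
  then show ?thesis by (auto simp: subconstituent_def)
qed

lemma dist_le_covering_radius: "x \<in> carrier_vec k \<Longrightarrow> dist_to_code x C \<le> covering_radius k C"
  unfolding covering_radius_def by (intro Max_ge) auto

lemma subconstituent_2:
  assumes "covering_radius k C \<le> 2"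
  shows "subconstituent k C 2 = {x \<in> carrier_vec k. M *\<^sub>v x \<in> E}"
proof -
  have "dist_to_code x C = 2 \<longleftrightarrow> M *\<^sub>v x \<in> E" if "x \<in> carrier_vec k" for x
    using dist_le_1_iff[OF that] dist_le_covering_radius[OF that] assms syndrome_carrier[OF that] by auto
  then show ?thesis by (auto simp: subconstituent_def)
qed

text \<open>
  The level is written with \<open>Suc\<close>, the normal form in which the simplifier leaves
  \<open>l + 1\<close> for \<open>l = 1\<close>.
\<close>

lemma card_neighbors_in_levels:
  assumes x: "x \<in> carrier_vec k"
  shows card_neighbors_level_0: "card (neighbors_in x (subconstituent k C 0)) = card {d \<in> D. M *\<^sub>v x + d = 0\<^sub>v m}"
    and card_neighbors_level_1: "card (neighbors_in x (subconstituent k C (Suc 0))) = card {d \<in> D. M *\<^sub>v x + d \<in> D}"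
    and card_neighbors_level_2: "covering_radius k C \<le> 2 \<Longrightarrow>
      card (neighbors_in x (subconstituent k C (Suc (Suc 0)))) = card {d \<in> D. M *\<^sub>v x + d \<in> E}"
  unfolding subconstituent_0 subconstituent_1 numeral_2_eq_2[symmetric]
  using card_neighbors_by_syndrome[OF x, of "{0\<^sub>v m}"] card_neighbors_by_syndrome[OF x, of D]
    card_neighbors_by_syndrome[OF x, of E]
  by (simp_all only: subconstituent_2 singleton_iff)

text \<open>
  The three subconstituents are the preimages of \<open>{0}\<close>, \<open>D\<close> and \<open>E\<close> under the syndrome map. Complete
  regularity makes \<open>b 1\<close> and \<open>c 2\<close> constant on the syndromes that occur, and every vector occurs by
  surjectivity. A syndrome in \<open>D\<close> has one neighbour at level \<open>0\<close> and \<open>b 1\<close> at level \<open>2\<close>, hence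
  \<open>card D - 1 - b 1\<close> at level \<open>1\<close>.
\<close>

lemma completely_regular_imp_partial_difference_set:
  assumes cr: "completely_regular k C" and radius: "covering_radius k C = 2"
    and surj: "(\<lambda>x. M *\<^sub>v x) ` carrier_vec k = carrier_vec m"
  shows "partial_difference_set m D"
proof -
  from cr obtain b c where bc: "\<And>l x. l \<le> 2 \<Longrightarrow> x \<in> subconstituent k C l \<Longrightarrow>
      (0 < l \<longrightarrow> card (neighbors_in x (subconstituent k C (l - 1))) = c l) \<and>
      card (neighbors_in x (subconstituent k C (l + 1))) = b l"
    unfolding completely_regular_def radius by blast
  have attained: "\<exists>x\<in>carrier_vec k. M *\<^sub>v x = s" if "s \<in> carrier_vec m" for s
  proof -
    have "s \<in> (\<lambda>x. M *\<^sub>v x) ` carrier_vec k" using surj that by simp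
    then show ?thesis by blast
  qed
  have S2: "subconstituent k C 2 = {x \<in> carrier_vec k. M *\<^sub>v x \<in> E}"
    using subconstituent_2 radius by simp
  have "card {d \<in> D. s + d \<in> D} = card D - 1 - b 1" if s: "s \<in> D" for s
  proof -
    obtain x where x: "x \<in> carrier_vec k" "M *\<^sub>v x = s"
      using attained[OF subsetD[OF points_carrier s]] by blast
    with s have "x \<in> subconstituent k C 1" by (simp add: subconstituent_1)
    from bc[OF _ this] have "card (neighbors_in x (subconstituent k C 2)) = b 1"
      by (simp add: numeral_2_eq_2)
    then have "card {d \<in> D. s + d \<in> E} = b 1"
      using card_neighbors_level_2[OF x(1)] radius by (simp only: x(2) numeral_2_eq_2[symmetric])
    moreover have sc: "s \<in> carrier_vec m" using s points_carrier by blast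
    ultimately show ?thesis
      using card_translates_split[OF points_carrier zero_notin_points points_carrier sc]
        card_translates_to_zero[OF points_carrier points_uminus sc] s by simp
  qed
  moreover have "card {d \<in> D. s + d \<in> D} = c 2" if s: "s \<in> E" for s
  proof -
    obtain x where x: "x \<in> carrier_vec k" "M *\<^sub>v x = s"
      using attained[of s] s by blast
    with s have "x \<in> subconstituent k C 2" by (simp add: S2)
    from bc[OF _ this] have "card (neighbors_in x (subconstituent k C 1)) = c 2" by simp
    then show ?thesis
      using card_neighbors_level_1[OF x(1)] by (simp add: x(2))
  qed
  ultimately show ?thesis unfolding partial_difference_set_def by blast
qed

text \<open>
  Every syndrome is a sum of elements of \<open>D\<close>, one for each nonzero coordinate of the word.
\<close>

lemma syndromes_in_additive_set:
  assumes zero: "0\<^sub>v m \<in> T" and closed: "\<And>s d. s \<in> T \<Longrightarrow> d \<in> D \<Longrightarrow> s + d \<in> T"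
    and x: "x \<in> carrier_vec k"
  shows "M *\<^sub>v x \<in> T"
  using x
proof (induction "hamming_dist x (0\<^sub>v k)" arbitrary: x)
  case 0
  then have "x = 0\<^sub>v k" by (metis hamming_dist_eq_0_iff zero_carrier_vec)
  then show ?case using syndrome_zero zero by simp
next
  case (Suc w)
  let ?supp = "\<lambda>x. {i. i < dim_vec x \<and> x $ i \<noteq> 0\<^sub>v k $ i}"
  have "?supp x \<noteq> {}" using Suc.hyps(2) unfolding hamming_dist_def by fastforce
  then obtain i where i: "i < k" "x $ i \<noteq> 0" using Suc.prems by auto
  define y where "y = x + (- (x $ i)) \<cdot>\<^sub>v unit_vec k i"
  have y: "y \<in> carrier_vec k" using Suc.prems by (simp add: y_def)
  have "?supp y = ?supp x - {i}"
    using Suc.prems i by (auto simp: y_def unit_vec_def split: if_splits)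
  moreover have "i \<in> ?supp x" using i Suc.prems by auto
  ultimately have "hamming_dist y (0\<^sub>v k) = w"
    using Suc.hyps(2) unfolding hamming_dist_def by (simp add: card_Diff_singleton)
  then have "M *\<^sub>v y \<in> T" using Suc.hyps(1) y by blast
  moreover have "x = y + (x $ i) \<cdot>\<^sub>v unit_vec k i"
    using Suc.prems by (auto simp: y_def vec_eq_iff)
  then have "M *\<^sub>v x = M *\<^sub>v y + (x $ i) \<cdot>\<^sub>v col M i"
    using syndrome_step[OF y i(1), of "x $ i"] by simp
  moreover have "(x $ i) \<cdot>\<^sub>v col M i \<in> D" using i M by (auto simp: points_def)
  ultimately show ?case using closed by simp
qed

text \<open>
  If \<open>\<mu> > 0\<close>, every vector outside \<open>D \<union> {0}\<close> is a sum of two elements of \<open>D\<close>, so all distances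
  are at most two. If \<open>\<mu> = 0\<close>, then \<open>D \<union> {0}\<close> is closed under adding elements of \<open>D\<close>, so it contains all
  syndromes and all distances are at most one. In both cases the level of a word is decided by whether
  its syndrome is in \<open>{0}\<close>, \<open>D\<close> or \<open>E\<close>, and the parameters are constant on each of these sets.
\<close>

lemma partial_difference_set_imp_completely_regular:
  assumes pds: "partial_difference_set m D"
  shows "completely_regular k C \<and> covering_radius k C \<le> 2"
proof -
  from pds obtain l \<mu> where l: "\<And>s. s \<in> D \<Longrightarrow> card {d \<in> D. s + d \<in> D} = l"
    and \<mu>: "\<And>s. s \<in> E \<Longrightarrow> card {d \<in> D. s + d \<in> D} = \<mu>"
    unfolding partial_difference_set_def by blast
  have "dist_to_code x C \<le> 2" if x: "x \<in> carrier_vec k" for x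
  proof (cases "M *\<^sub>v x \<in> E")
    case False
    then have "dist_to_code x C \<le> 1"
      using dist_le_1_iff[OF x] syndrome_carrier[OF x] by blast
    then show ?thesis by simp
  next
    case True
    show ?thesis
    proof (cases "\<mu> = 0")
      case False
      with \<mu>[OF True] have "{d \<in> D. M *\<^sub>v x + d \<in> D} \<noteq> {}" by (metis card.empty)
      then show ?thesis using dist_le_2[OF x] by blast
    next
      case mu: True
      \<comment> \<open>If \<open>s + d\<close> were in \<open>E\<close> with \<open>s\<close> in \<open>D\<close>, then \<open>-d\<close> would be counted by \<open>\<mu>\<close> at \<open>s + d\<close>.\<close>
      have finD: "finite D" using points_carrier by (rule finite_subset) simp
      have "s + d \<in> insert (0\<^sub>v m) D" if "s \<in> insert (0\<^sub>v m) D" "d \<in> D" for s d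
      proof (rule ccontr)
        assume out: "s + d \<notin> insert (0\<^sub>v m) D"
        have sd: "s \<in> carrier_vec m" "d \<in> carrier_vec m" using that points_carrier by auto
        with out have "s + d \<in> E" by simp
        from \<mu>[OF this] mu finD have "{e \<in> D. (s + d) + e \<in> D} = {}" by simp
        moreover have "(s + d) + - d = s" using sd by (intro eq_vecI) simp_all
        ultimately have "s \<notin> D" using points_uminus[OF that(2)] by auto
        with that have "s = 0\<^sub>v m" by simp
        with out that(2) sd show False by simp
      qed
      then have "M *\<^sub>v x \<in> insert (0\<^sub>v m) D"
        using syndromes_in_additive_set[of "insert (0\<^sub>v m) D"] x by blast
      with True show ?thesis by blast
    qed
  qed
  moreover have "carrier_vec k \<noteq> ({} :: 'a vec set)" using zero_carrier_vec by blast
  ultimately have radius: "covering_radius k C \<le> 2"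
    unfolding covering_radius_def by (subst Max_le_iff) auto
  let ?\<rho> = "covering_radius k C"
  \<comment> \<open>The covering radius can be smaller than two. The last \<open>b\<close> is then zero because the next
    level is empty, whatever the formula for that level gives otherwise.\<close>
  let ?b = "\<lambda>l'. if l' = ?\<rho> then 0 else if l' = 0 then card D else card D - 1 - l"
  let ?c = "\<lambda>l'. if l' = 0 then 0 else if l' = 1 then 1 else \<mu>"
  have beyond: "subconstituent k C (?\<rho> + 1) = {}"
    using dist_le_covering_radius by (fastforce simp: subconstituent_def)
  have level: "(0 < i \<longrightarrow> card (neighbors_in x (subconstituent k C (i - 1))) = ?c i) \<and>
      card (neighbors_in x (subconstituent k C (i + 1))) = ?b i"
    if i: "i \<le> ?\<rho>" and x: "x \<in> subconstituent k C i" for i x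
  proof -
    have xc: "x \<in> carrier_vec k" using x by (simp add: subconstituent_def)
    note sc = syndrome_carrier[OF xc]
    have up: "card (neighbors_in x (subconstituent k C (i + 1))) = (if i = ?\<rho> then 0 else N)"
      if "card (neighbors_in x (subconstituent k C (i + 1))) = N" for N
    proof (cases "i = ?\<rho>")
      case True
      then show ?thesis using beyond by (simp add: neighbors_in_def)
    qed (use that in simp)
    consider "i = 0" | "i = 1" | "i = 2" using i radius by linarith
    then show ?thesis
    proof cases
      case 1
      then have "M *\<^sub>v x = 0\<^sub>v m" using x by (simp add: subconstituent_0)
      moreover have "{d \<in> D. 0\<^sub>v m + d \<in> D} = D"
        using points_carrier by (auto dest: subsetD)
      ultimately have "card (neighbors_in x (subconstituent k C (i + 1))) = card D"
        using card_neighbors_level_1[OF xc] 1 by simp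
      from up[OF this] show ?thesis using 1 by simp
    next
      case 2
      then have s: "M *\<^sub>v x \<in> D" using x by (simp add: subconstituent_1)
      have down: "card {d \<in> D. M *\<^sub>v x + d = 0\<^sub>v m} = 1"
        using card_translates_to_zero[OF points_carrier points_uminus sc] s by simp
      have "card {d \<in> D. M *\<^sub>v x + d \<in> E} = card D - 1 - l"
        using card_translates_split[OF points_carrier zero_notin_points points_carrier sc]
        unfolding down l[OF s] by simp
      then have "card (neighbors_in x (subconstituent k C (i + 1))) = card D - 1 - l"
        using card_neighbors_level_2[OF xc radius] 2 by simp
      note up[OF this]
      moreover have "card (neighbors_in x (subconstituent k C (i - 1))) = 1"
        using card_neighbors_level_0[OF xc] 2 down by simp
      ultimately show ?thesis using 2 by simp
    next
      case 3
      then have "M *\<^sub>v x \<in> E" using x subconstituent_2[OF radius] by simp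
      then have "card (neighbors_in x (subconstituent k C (i - 1))) = \<mu>"
        using card_neighbors_level_1[OF xc] \<mu> 3 by simp
      moreover have "i = ?\<rho>" using 3 i radius by simp
      ultimately show ?thesis using up[OF refl] 3 by simp
    qed
  qed
  have "completely_regular k C"
    unfolding completely_regular_def
    by (rule exI[of _ ?b], rule exI[of _ ?c]) (use level in auto)
  with radius show ?thesis by simp
qed

end

section \<open>Columns of a parity-check matrix of a Hamming code\<close>

text \<open>
  A zero column is impossible next to a second column, because \<open>0\<close> and any vector are linearly
  dependent. A nonzero vector that is on none of the projective points of the columns could be added to
  them as a further column, against maximality.
\<close>

lemma
  fixes H :: "'a::{field,finite} mat"
  assumes H: "hamming_parity_check m H" and two: "dim_col H \<ge> 2"
  shows hamming_projective_system: "projective_system m (dim_col H) H"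
    and hamming_points: "points H = carrier_vec m - {0\<^sub>v m}"
proof -
  let ?C = "set (cols H)"
  have Hc: "H \<in> carrier_mat m (dim_col H)" and dist: "distinct (cols H)"
    and max: "maximal ?C (pairwise_lin_indpt m)"
    using H by (auto simp: hamming_parity_check_def)
  have C: "?C = col H ` {..<dim_col H}" by (auto simp: cols_def)
  have col: "col H i \<in> carrier_vec m" for i using Hc by auto
  have col_eq: "i = j" if "col H i = col H j" "i < dim_col H" "j < dim_col H" for i j
    using dist that by (metis cols_length cols_nth nth_eq_iff_index_eq)
  have indpt: "a = 0 \<and> b = 0"
    if "a \<cdot>\<^sub>v col H i + b \<cdot>\<^sub>v col H j = 0\<^sub>v m" "i < dim_col H" "j < dim_col H" "i \<noteq> j" for a b i j
  proof -
    have ne: "col H i \<noteq> col H j" using col_eq that by blast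
    moreover have "col H i \<in> ?C" "col H j \<in> ?C" using that by (auto simp: C)
    ultimately show ?thesis
      using max that(1) lin_indpt_pair_iff[OF col col ne]
      by (auto simp: maximal_def pairwise_lin_indpt_def pairwise_def)
  qed
  have nz: "col H i \<noteq> 0\<^sub>v m" if i: "i < dim_col H" for i
  proof
    assume z: "col H i = 0\<^sub>v m"
    obtain j where j: "j < dim_col H" "j \<noteq> i"
    proof (cases "i = 0")
      case True then show ?thesis using two that[of 1] by simp
    next
      case False then show ?thesis using two that[of 0] by simp
    qed
    have "1 \<cdot>\<^sub>v col H i + 0 \<cdot>\<^sub>v col H j = 0\<^sub>v m"
      using col[of j] smult_vec_eq_zero_iff[OF col, of 0 j] by (simp add: z)
    from indpt[OF this i j(1)] j show False by auto
  qed
  show "projective_system m (dim_col H) H"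
  proof (unfold_locales, rule Hc)
    fix a b i j
    assume eq: "a \<cdot>\<^sub>v col H i = b \<cdot>\<^sub>v col H j" and ab: "a \<noteq> 0" "b \<noteq> 0"
      and ij: "i < dim_col H" "j < dim_col H"
    have "a \<cdot>\<^sub>v col H i + (- b) \<cdot>\<^sub>v col H j = 0\<^sub>v m"
      using col by (subst add_vec_eq_zero_iff) (simp_all add: eq uminus_smult_vec)
    with indpt ab ij have i: "i = j" by blast
    have "(a - b) \<cdot>\<^sub>v col H i = a \<cdot>\<^sub>v col H i - b \<cdot>\<^sub>v col H i"
      by (intro eq_vecI) (auto simp: left_diff_distrib)
    also have "\<dots> = 0\<^sub>v m"
      using eq col[of i] by (simp add: i)
    finally have "(a - b) \<cdot>\<^sub>v col H i = 0\<^sub>v m" .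
    then show "a = b \<and> i = j"
      using nz[OF ij(1)] i by (simp add: smult_vec_eq_zero_iff[OF col])
  qed (rule nz)
  show "points H = carrier_vec m - {0\<^sub>v m}"
  proof (intro equalityI subsetI)
    fix v assume "v \<in> points H"
    then obtain a i where v: "v = a \<cdot>\<^sub>v col H i" "a \<noteq> 0" "i < dim_col H"
      by (auto simp: points_def)
    have "v \<noteq> 0\<^sub>v m"
      using v nz by (simp add: smult_vec_eq_zero_iff[OF col])
    then show "v \<in> carrier_vec m - {0\<^sub>v m}" using v col[of i] by auto
  next
    fix v :: "'a vec" assume "v \<in> carrier_vec m - {0\<^sub>v m}"
    then have v: "v \<in> carrier_vec m" "v \<noteq> 0\<^sub>v m" by auto
    show "v \<in> points H"
    proof (rule ccontr)
      assume notin: "v \<notin> points H"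
      have vC: "v \<notin> ?C"
      proof
        assume "v \<in> ?C"
        then obtain i where "i < dim_col H" "v = 1 \<cdot>\<^sub>v col H i" by (auto simp: C)
        moreover have "(1 :: 'a) \<noteq> 0" by simp
        ultimately show False using notin unfolding points_def by blast
      qed
      have ind: "a = 0 \<and> b = 0"
        if i: "i < dim_col H" and ab: "a \<cdot>\<^sub>v v + b \<cdot>\<^sub>v col H i = 0\<^sub>v m" for a b i
      proof -
        have eq: "a \<cdot>\<^sub>v v = (- b) \<cdot>\<^sub>v col H i"
          using ab v col[of i] by (simp add: add_vec_eq_zero_iff uminus_smult_vec)
        have a: "a = 0"
        proof (rule ccontr)
          assume "a \<noteq> 0"
          from smult_eq_smult_vec[OF eq this] have veq: "v = (- b / a) \<cdot>\<^sub>v col H i" .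
          then have "- b / a \<noteq> 0" using v(2) smult_vec_eq_zero_iff[OF col, of _ i] by blast
          with veq show False using notin i unfolding points_def by blast
        qed
        have "0\<^sub>v m = (- b) \<cdot>\<^sub>v col H i"
          using eq a smult_vec_eq_zero_iff[OF v(1), of 0] by simp
        then have "b = 0"
          using nz[OF i] smult_vec_eq_zero_iff[OF col, of "- b" i] by auto
        with a show ?thesis by simp
      qed
      have li: "LinearCombinations.module.lin_indpt class_ring (module_vec TYPE('a) m) {v, u}"
        if u: "u \<in> ?C" for u
      proof -
        obtain i where i: "i < dim_col H" "u = col H i" using u by (auto simp: C)
        moreover from u vC have "v \<noteq> u" by blast
        ultimately show ?thesis
          using lin_indpt_pair_iff[OF v(1) col, of i] ind by simp
      qed
      have "pairwise_lin_indpt m (insert v ?C)"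
        using max v(1) li
        by (auto simp: maximal_def pairwise_lin_indpt_def pairwise_insert insert_commute)
      then have "insert v ?C = ?C" using max by (auto simp: maximal_def)
      with vC show False by blast
    qed
  qed
qed

lemma
  assumes H: "H \<in> carrier_mat m n" and I: "I \<subseteq> {0..<n}"
  shows submatrix_columns_carrier: "submatrix H UNIV I \<in> carrier_mat m (card I)"
    and col_submatrix_columns: "j < card I \<Longrightarrow> col (submatrix H UNIV I) j = col H (pick I j)"
proof -
  have "{i. i < dim_row H \<and> i \<in> UNIV} = {..<m}" "{j. j < dim_col H \<and> j \<in> I} = I"
    using H I by auto
  then have dims: "card {i. i < dim_row H \<and> i \<in> UNIV} = m" "card {j. j < dim_col H \<and> j \<in> I} = card I"
    by simp_all
  show sub: "submatrix H UNIV I \<in> carrier_mat m (card I)"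
    using dims by (auto simp: dim_submatrix)
  assume j: "j < card I"
  then have "pick I j < dim_col H" using pick_le[of j "dim_col H" I] dims by simp
  then show "col (submatrix H UNIV I) j = col H (pick I j)"
    using sub H j dims by (intro eq_vecI) (auto simp: submatrix_index pick_UNIV)
qed

lemma bij_betw_pick:
  assumes "finite I"
  shows "bij_betw (pick I) {..<card I} I"
proof (rule bij_betw_imageI)
  show "inj_on (pick I) {..<card I}"
  proof (rule linorder_inj_onI')
    fix i j assume "i \<in> {..<card I}" "j \<in> {..<card I}" "i < j"
    then show "pick I i \<noteq> pick I j" using pick_mono[of j I i] by simp
  qed
  show "pick I ` {..<card I} = I"
  proof (intro equalityI subsetI)
    fix i assume i: "i \<in> I"
    then have "card {a \<in> I. a < i} < card I"
      using assms by (intro psubset_card_mono) auto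
    then show "i \<in> pick I ` {..<card I}"
      using pick_card_in_set[OF i] by force
  qed (use pick_in_set in auto)
qed

lemma (in projective_system) submatrix_columns_projective_system:
  assumes I: "I \<subseteq> {0..<k}"
  shows "projective_system m (card I) (submatrix M UNIV I)"
proof -
  note col = col_submatrix_columns[OF M I]
  have pick: "pick I i < k" if "i < card I" for i
    using pick_in_set[of i I] that I by auto
  have inj: "inj_on (pick I) {..<card I}"
    using bij_betw_pick[of I] I by (auto simp: bij_betw_def intro: finite_subset)
  show ?thesis
  proof (unfold_locales, rule submatrix_columns_carrier[OF M I])
    fix a b i j
    assume "a \<cdot>\<^sub>v col (submatrix M UNIV I) i = b \<cdot>\<^sub>v col (submatrix M UNIV I) j"
      "a \<noteq> 0" "b \<noteq> 0" and ij: "i < card I" "j < card I"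
    then have "a = b \<and> pick I i = pick I j" using smult_col_inj pick col by simp
    then show "a = b \<and> i = j" using inj ij by (auto dest: inj_onD)
  next
    fix i assume "i < card I"
    then show "col (submatrix M UNIV I) i \<noteq> 0\<^sub>v m" using col_nonzero pick col by simp
  qed
qed

lemma points_submatrix_columns:
  assumes H: "H \<in> carrier_mat m n" and I: "I \<subseteq> {0..<n}"
  shows "points (submatrix H UNIV I) = {a \<cdot>\<^sub>v col H i | a i. a \<noteq> 0 \<and> i \<in> I}"
proof -
  have dim: "dim_col (submatrix H UNIV I) = card I"
    using submatrix_columns_carrier[OF H I] by blast
  have "pick I ` {..<card I} = I"
    using bij_betw_pick[of I] I by (auto simp: bij_betw_def intro: finite_subset)
  then have mem: "i \<in> I \<longleftrightarrow> (\<exists>j<card I. i = pick I j)" for i by auto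
  show ?thesis
    unfolding points_def dim mem
    using col_submatrix_columns[OF H I] by (intro Collect_cong) metis
qed

text \<open>
  Each nonzero vector is on the projective point of exactly one column, so a partition of the columns
  partitions the nonzero vectors.
\<close>

lemma (in projective_system) points_complementary_columns:
  assumes all: "points M = carrier_vec m - {0\<^sub>v m}" and I: "I \<subseteq> {0..<k}"
  shows "points (submatrix M UNIV ({0..<k} - I)) = carrier_vec m - insert (0\<^sub>v m) (points (submatrix M UNIV I))"
proof -
  let ?P = "\<lambda>J. {a \<cdot>\<^sub>v col M i | a i. a \<noteq> 0 \<and> i \<in> J}"
  have P: "points (submatrix M UNIV J) = ?P J" if "J \<subseteq> {0..<k}" for J
    using points_submatrix_columns[OF M that] .
  have "points M = ?P {0..<k}" using M by (auto simp: points_def)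
  also have "\<dots> = ?P I \<union> ?P ({0..<k} - I)" using I by blast
  finally have un: "?P I \<union> ?P ({0..<k} - I) = carrier_vec m - {0\<^sub>v m}" using all by simp
  have "?P I \<inter> ?P ({0..<k} - I) = {}"
  proof (rule ccontr)
    assume "?P I \<inter> ?P ({0..<k} - I) \<noteq> {}"
    then obtain a i b j where "a \<cdot>\<^sub>v col M i = b \<cdot>\<^sub>v col M j" "a \<noteq> 0" "b \<noteq> 0"
      "i \<in> I" "j \<in> {0..<k} - I" by blast
    then show False using smult_col_inj[of a i b j] I by auto
  qed
  with un show ?thesis unfolding P[OF I] P[OF Diff_subset] by blast
qed

section \<open>Supplementary codes\<close>

theorem theorem3p5:
  fixes H H\<^sub>A H\<^sub>B :: "'a::{field,finite} mat"
    and A B :: "'a vec set"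
    and S :: "nat set"
    and m n n\<^sub>A n\<^sub>B :: nat
  assumes m: "m > 1"
    and H: "hamming_parity_check m H"
    and n: "n = dim_col H"
    and S: "S \<subseteq> {0..<n}" "S \<noteq> {}"
    and n\<^sub>A: "n\<^sub>A = card S" "n\<^sub>A < n"
    and n\<^sub>B: "n\<^sub>B = n - n\<^sub>A"
    and H\<^sub>A: "H\<^sub>A = submatrix H UNIV S"
    and H\<^sub>B: "H\<^sub>B = submatrix H UNIV ({0..<n} - S)"
    and A: "A = mat_kernel H\<^sub>A"
    and B: "B = mat_kernel H\<^sub>B"
    and dim_A: "int (kernel_dim H\<^sub>A) = int n\<^sub>A - int m"
    and A_cr: "completely_regular n\<^sub>A A"
    and A_radius: "covering_radius n\<^sub>A A = 2"
  shows "completely_regular n\<^sub>B B \<and> covering_radius n\<^sub>B B \<le> 2"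
proof -
  have "0 < card S" using S by (auto simp: card_gt_0_iff intro: finite_subset)
  then have two: "2 \<le> n" using n\<^sub>A by linarith
  interpret H: projective_system m n H
    using hamming_projective_system[OF H] two n by simp
  interpret A: projective_system m n\<^sub>A H\<^sub>A
    unfolding H\<^sub>A n\<^sub>A(1) by (rule H.submatrix_columns_projective_system[OF S(1)])
  have "finite S" using S(1) by (rule finite_subset) simp
  then have "n\<^sub>B = card ({0..<n} - S)"
    using S(1) by (simp add: n\<^sub>B n\<^sub>A(1) card_Diff_subset)
  then interpret B: projective_system m n\<^sub>B H\<^sub>B
    unfolding H\<^sub>B using H.submatrix_columns_projective_system[OF Diff_subset] by simp
  have points_B: "points H\<^sub>B = carrier_vec m - insert (0\<^sub>v m) (points H\<^sub>A)"
    unfolding H\<^sub>A H\<^sub>B using hamming_points[OF H] two n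
    by (intro H.points_complementary_columns[OF _ S(1)]) simp
  have "partial_difference_set m (points H\<^sub>A)"
    using A.completely_regular_imp_partial_difference_set[OF A_cr[unfolded A] A_radius[unfolded A]]
      image_mult_mat_vec_eq_carrier_vec[OF A.M dim_A] by blast
  then have "partial_difference_set m (points H\<^sub>B)"
    unfolding points_B
    by (intro partial_difference_set_complement A.points_carrier A.zero_notin_points A.points_uminus)
  then show ?thesis
    unfolding B by (rule B.partial_difference_set_imp_completely_regular)
qed

end
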